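(* For $i=1,2$ let $G_{i}$ be an $r_{i}$-regular graph on $n_{i}$ vertices, where the adjacency spectrum of $G_1$ is $\{r_{1}=\lambda_{1},\lambda_{2},\ldots,\lambda_{n_{1}}\}$ and that of $G_2$ is $\{r_{2}=\mu_{1},\mu_{2},\ldots,\mu_{n_{2}}\}$. Then the distance signless Laplacian spectrum of the join $G_{1}\nabla G_{2}$ consists of the eigenvalues $2n_{1}+n_{2}-r_{1}-\lambda_{j}-4$ for $j=2,\ldots,n_{1}$, $2n_{2}+n_{1}-r_{2}-\mu_{j}-4$ for $j=2,\ldots,n_{2}$, and the two eigenvalues $$\frac{5}{2}(n_{1}+n_{2})-r_{1}-r_{2}-4\pm\frac{\sqrt{\Delta}}{2},$$ where $\Delta=9n_{1}^{2}-14n_{1}n_{2}-12n_{1}r_{1}+12n_{1}r_{2}+9n_{2}^{2}+12n_{2}r_{1}-12n_{2}r_{2}+4r_{1}^{2}-8r_{1}r_{2}+4r_{2}^{2}$.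
   Context: The join $G_1\nabla G_2$ of vertex-disjoint graphs is obtained from $G_1\cup G_2$ by joining every vertex of $G_1$ to every vertex of $G_2$. For a connected graph, $\mathcal{D}$ is its distance matrix, $Tr$ the diagonal matrix of vertex transmissions ($Tr(u)=\sum_v d(u,v)$), and the distance signless Laplacian matrix is $\mathcal{Q}=Tr+\mathcal{D}$. Here $\mu_j$ denote adjacency eigenvalues of $G_2$. *)

theory Defs
  imports
    "Jordan_Normal_Form.Char_Poly"
    "Graph_Theory.Graph_Theory"
begin

text \<open>
  A finite simple graph is a \<open>pair_graph\<close>: a finite vertex set together with a symmetric,
  irreflexive set of ordered pairs, each undirected edge being represented by its two orientations.
\<close>

definition regular :: "'a pair_pre_digraph \<Rightarrow> nat \<Rightarrow> bool" where
  "regular G r \<longleftrightarrow> (\<forall>v \<in> pverts G. out_degree (with_proj G) v = r)"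

definition graph_join :: "'a pair_pre_digraph \<Rightarrow> 'a pair_pre_digraph \<Rightarrow> 'a pair_pre_digraph"
    (infixl \<open>\<nabla>\<close> 65) where
  "G \<nabla> H = \<lparr> pverts = pverts G \<union> pverts H,
             parcs = parcs G \<union> parcs H \<union> pverts G \<times> pverts H \<union> pverts H \<times> pverts G \<rparr>"

text \<open>
  Matrices are indexed by natural numbers, so a matrix indexed by a finite set \<open>V\<close> is formed along
  an arbitrary but fixed enumeration of \<open>V\<close>. Its characteristic polynomial, hence its spectrum,
  does not depend on that enumeration (lemma \<open>char_poly_enum_mat\<close> below).
\<close>

definition enumeration :: "'a set \<Rightarrow> 'a list" where
  "enumeration V = (SOME vs. distinct vs \<and> set vs = V)"

definition list_mat :: "'a list \<Rightarrow> ('a \<Rightarrow> 'a \<Rightarrow> 'b) \<Rightarrow> 'b mat" where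
  "list_mat vs f = mat (length vs) (length vs) (\<lambda>(i, j). f (vs ! i) (vs ! j))"

definition enum_mat :: "'a set \<Rightarrow> ('a \<Rightarrow> 'a \<Rightarrow> 'b) \<Rightarrow> 'b mat" where
  "enum_mat V = list_mat (enumeration V)"

definition adjacency_matrix :: "'a pair_pre_digraph \<Rightarrow> real mat" where
  "adjacency_matrix G = enum_mat (pverts G) (\<lambda>u v. if (u, v) \<in> parcs G then 1 else 0)"

text \<open>
  The distance is the least length of a walk. In a connected graph it is finite, so that
  \<open>real_of_ereal\<close> loses nothing; see lemma \<open>connected_graph_join\<close> for joins.
\<close>

definition graph_dist :: "'a pair_pre_digraph \<Rightarrow> 'a \<Rightarrow> 'a \<Rightarrow> real" where
  "graph_dist G u v = real_of_ereal (wf_digraph.\<mu> (with_proj G) (\<lambda>_. 1) u v)"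

definition distance_matrix :: "'a pair_pre_digraph \<Rightarrow> real mat" where
  "distance_matrix G = enum_mat (pverts G) (graph_dist G)"

definition transmission :: "'a pair_pre_digraph \<Rightarrow> 'a \<Rightarrow> real" where
  "transmission G u = (\<Sum>v \<in> pverts G. graph_dist G u v)"

definition transmission_matrix :: "'a pair_pre_digraph \<Rightarrow> real mat" where
  "transmission_matrix G = enum_mat (pverts G) (\<lambda>u v. if u = v then transmission G u else 0)"

definition distance_signless_laplacian :: "'a pair_pre_digraph \<Rightarrow> real mat" where
  "distance_signless_laplacian G = transmission_matrix G + distance_matrix G"

text \<open>
  Eigenvalues with algebraic multiplicity. Only real roots are counted, which are all the roots for
  the symmetric matrices considered here.
\<close>

definition mat_spectrum :: "real mat \<Rightarrow> real multiset" where
  "mat_spectrum A = proots (char_poly A)"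

lemma enumeration:
  assumes "finite V"
  shows "distinct (enumeration V)" "set (enumeration V) = V"
  using someI_ex[of "\<lambda>vs. distinct vs \<and> set vs = V"] finite_distinct_list[OF assms]
  unfolding enumeration_def by blast+

lemma char_poly_list_mat:
  fixes f :: "'a \<Rightarrow> 'a \<Rightarrow> 'b :: comm_ring_1"
  assumes "distinct vs" "distinct ws" "set vs = set ws"
  shows "char_poly (list_mat vs f) = char_poly (list_mat ws f)"
proof (rule char_poly_similar)
  define n where "n = length vs"
  have len: "length ws = n"
    using assms distinct_card unfolding n_def by metis
  define E :: "'a list \<Rightarrow> 'a list \<Rightarrow> 'b mat"
    where "E xs ys = mat n n (\<lambda>(i, j). if ys ! j = xs ! i then 1 else 0)" for xs ys
  have dim: "E xs ys \<in> carrier_mat n n" for xs ys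
    by (simp add: E_def)
  have entry: "(A * B) $$ (i, j) = (\<Sum>k = 0..<n. A $$ (i, k) * B $$ (k, j))"
    if "A \<in> carrier_mat n n" "B \<in> carrier_mat n n" "i < n" "j < n" for A B :: "'b mat" and i j
    using that by (auto simp: scalar_prod_def)
  have ex: "\<exists>k<n. ys ! k = xs ! i"
    if "length xs = n" "length ys = n" "set xs = set ys" "i < n" for i and xs ys :: "'a list"
    using that by (metis in_set_conv_nth)
  have pick: "(\<Sum>k = 0..<n. (if ys ! k = x then 1 else 0) * g (ys ! k)) = g x"
    if *: "length ys = n" "distinct ys" "\<exists>k<n. ys ! k = x" for g :: "'a \<Rightarrow> 'b" and ys x
  proof -
    obtain m where m: "m < n" "ys ! m = x"
      using * by blast
    have "(\<Sum>k = 0..<n. (if ys ! k = x then 1 else 0) * g (ys ! k)) = (\<Sum>k = 0..<n. if k = m then g x else 0)"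
      using * m by (intro sum.cong) (auto simp: nth_eq_iff_index_eq)
    then show ?thesis
      using m by simp
  qed
  have inv: "E xs ys * E ys xs = 1\<^sub>m n"
    if *: "length xs = n" "length ys = n" "set xs = set ys" "distinct xs" "distinct ys" for xs ys
  proof (rule eq_matI)
    fix i j assume "i < dim_row (1\<^sub>m n :: 'b mat)" "j < dim_col (1\<^sub>m n :: 'b mat)"
    then have ij: "i < n" "j < n" by auto
    have "(E xs ys * E ys xs) $$ (i, j)
        = (\<Sum>k = 0..<n. (if ys ! k = xs ! i then 1 else 0) * (if xs ! j = ys ! k then 1 else 0))"
      using ij by (simp add: E_def scalar_prod_def)
    also have "\<dots> = (if xs ! j = xs ! i then 1 else 0)"
      using pick[of ys "xs ! i" "\<lambda>y. if xs ! j = y then 1 else 0"] ex[of xs ys i] * ij by simp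
    also have "\<dots> = (1\<^sub>m n :: 'b mat) $$ (i, j)"
      using * ij by (auto simp: nth_eq_iff_index_eq)
    finally show "(E xs ys * E ys xs) $$ (i, j) = (1\<^sub>m n :: 'b mat) $$ (i, j)" .
  qed (auto simp: E_def)
  have conj: "list_mat vs f = E vs ws * list_mat ws f * E ws vs"
  proof (rule eq_matI)
    fix i j assume "i < dim_row (E vs ws * list_mat ws f * E ws vs)"
      and "j < dim_col (E vs ws * list_mat ws f * E ws vs)"
    then have ij: "i < n" "j < n" by (auto simp: E_def)
    have row: "(E vs ws * list_mat ws f) $$ (i, k) = f (vs ! i) (ws ! k)" if "k < n" for k
    proof -
      have "(E vs ws * list_mat ws f) $$ (i, k)
          = (\<Sum>l = 0..<n. (if ws ! l = vs ! i then 1 else 0) * f (ws ! l) (ws ! k))"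
        using ij that len by (simp add: E_def list_mat_def scalar_prod_def)
      then show ?thesis
        using pick[of ws "vs ! i" "\<lambda>y. f y (ws ! k)"] ex[of vs ws i] assms ij len n_def by simp
    qed
    have dimP: "E vs ws * list_mat ws f \<in> carrier_mat n n"
      using len by (auto simp: E_def list_mat_def)
    have "(E vs ws * list_mat ws f * E ws vs) $$ (i, j)
        = (\<Sum>k = 0..<n. (E vs ws * list_mat ws f) $$ (i, k) * E ws vs $$ (k, j))"
      using entry[OF dimP dim ij] .
    also have "\<dots> = (\<Sum>k = 0..<n. (if ws ! k = vs ! j then 1 else 0) * f (vs ! i) (ws ! k))"
      using row ij by (intro sum.cong) (auto simp: E_def)
    also have "\<dots> = list_mat vs f $$ (i, j)"
      using pick[of ws "vs ! j" "f (vs ! i)"] ex[of vs ws j] assms ij len n_def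
      by (simp add: list_mat_def)
    finally show "list_mat vs f $$ (i, j) = (E vs ws * list_mat ws f * E ws vs) $$ (i, j)" by simp
  qed (auto simp: E_def list_mat_def n_def)
  show "similar_mat (list_mat vs f) (list_mat ws f)"
  proof (rule similar_matI)
    show "{list_mat vs f, list_mat ws f, E vs ws, E ws vs} \<subseteq> carrier_mat n n"
      using dim len by (auto simp: list_mat_def n_def)
    show "E vs ws * E ws vs = 1\<^sub>m n" "E ws vs * E vs ws = 1\<^sub>m n"
      using inv assms len n_def by metis+
  qed (rule conj)
qed

lemma char_poly_enum_mat:
  fixes f :: "'a \<Rightarrow> 'a \<Rightarrow> 'b :: comm_ring_1"
  assumes "distinct vs"
  shows "char_poly (enum_mat (set vs) f) = char_poly (list_mat vs f)"
  unfolding enum_mat_def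
  by (rule char_poly_list_mat) (use assms enumeration[of "set vs"] in auto)

lemma pair_graph_graph_join:
  assumes "pair_graph G" "pair_graph H" "pverts G \<inter> pverts H = {}"
  shows "pair_graph (G \<nabla> H)"
proof -
  interpret G: pair_graph G by fact
  interpret H: pair_graph H by fact
  show ?thesis
  proof (unfold_locales, goal_cases)
    case 6
    show ?case
      using G.arcs_symmetric H.arcs_symmetric
      by (auto simp: graph_join_def symmetric_def sym_def)
  qed (use assms(3) G.no_loops' H.no_loops' in
      \<open>auto simp: graph_join_def dest: G.wellformed' H.wellformed'\<close>)
qed

lemma connected_graph_join:
  assumes "pair_graph G" "pair_graph H" "pverts G \<inter> pverts H = {}"
    and "pverts G \<noteq> {}" "pverts H \<noteq> {}"
  shows "connected (with_proj (G \<nabla> H))"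
proof -
  interpret J: pair_graph "G \<nabla> H"
    using assms by (intro pair_graph_graph_join)
  have step: "u \<rightarrow>\<^sup>*\<^bsub>with_proj (G \<nabla> H)\<^esub> v"
    if "u \<in> pverts G \<and> v \<in> pverts H \<or> u \<in> pverts H \<and> v \<in> pverts G" for u v
    using that by (intro J.reachable_adjI) (auto simp: graph_join_def)
  obtain a b where ab: "a \<in> pverts G" "b \<in> pverts H"
    using assms by blast
  have "strongly_connected (with_proj (G \<nabla> H))"
  proof (rule strongly_connectedI)
    show "verts (with_proj (G \<nabla> H)) \<noteq> {}"
      using ab by (auto simp: graph_join_def)
    fix u v assume "u \<in> verts (with_proj (G \<nabla> H))" "v \<in> verts (with_proj (G \<nabla> H))"
    then have "u \<in> pverts G \<union> pverts H" "v \<in> pverts G \<union> pverts H"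
      by (auto simp: graph_join_def)
    then show "u \<rightarrow>\<^sup>*\<^bsub>with_proj (G \<nabla> H)\<^esub> v"
      using step[of u v] step[of u a] step[of a v] step[of u b] step[of b v] ab J.reachable_trans
      by blast
  qed
  then show ?thesis
    unfolding connected_def strongly_connected_def by (simp add: J.reachable_mk_symmetricI)
qed

end

theory Submission
  imports Defs
begin

text \<open>
  A join of two nonempty graphs has diameter at most 2, so its distance signless Laplacian is
  \<open>C + V * W\<close>, where \<open>C\<close> is block diagonal with blocks \<open>c\<^sub>i 1 - A\<^sub>i\<close> (\<open>A\<^sub>i\<close> the adjacency matrix of
  \<open>G\<^sub>i\<close>), the two rows of \<open>W\<close> are the indicators of the two vertex sets, and \<open>V\<close> carries the
  weights 2 (inside a part) and 1 (across). Regularity gives \<open>W * C = D * W\<close> with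
  \<open>D = diag(c\<^sub>1 - r\<^sub>1, c\<^sub>2 - r\<^sub>2)\<close>, hence
  \<open>char_poly (C + V * W) * char_poly D = char_poly C * char_poly (D + W * V)\<close>: the roots of \<open>D\<close>
  are replaced by those of the \<open>2 \<times> 2\<close> quotient matrix \<open>D + W * V\<close>.
\<close>

section \<open>The spectrum of a reflected matrix \<open>c\<close> 1 - \<open>A\<close>\<close>

lemma proots_pcompose_reflect:
  fixes p :: "'a :: {idom, ring_char_0} poly"
  shows "proots (pcompose p [:c, -1:]) = image_mset (\<lambda>x. c - x) (proots p)"
proof (induction p rule: poly_root_induct[where P = "\<lambda>_. True"])
  case (no_roots p)
  have p0: "p \<noteq> 0"
    using no_roots by auto
  then have "pcompose p [:c, -1:] \<noteq> 0"
    by (simp add: pcompose_eq_0_iff)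
  \<comment> \<open>A root \<open>t\<close> of the composite would give the root
    \<open>c - t\<close> of \<open>p\<close>, so both multisets are empty.\<close>
  with p0 no_roots have "set_mset (proots p) = {}" "set_mset (proots (pcompose p [:c, -1:])) = {}"
    by (simp_all add: poly_pcompose)
  then show ?case
    by simp
next
  case (root a p)
  \<comment> \<open>The factor a - X turns into X - (c - a), which moves the root from
    \<open>a\<close> to \<open>c - a\<close>.\<close>
  have shift: "pcompose ([:a, -1:] * p) [:c, -1:] = [:a - c, 1:] * pcompose p [:c, -1:]"
    by (simp add: pcompose_mult pcompose_pCons del: mult_pCons_left)
  have "proots [:a, -1:] = proots (- [:- a, 1:])"
    by simp
  also have "\<dots> = {#a#}"
    by (subst proots_uminus) simp
  finally have lin: "proots [:a, -1:] = {#a#}" .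
  show ?case
  proof (cases "p = 0")
    case False
    then have "pcompose p [:c, -1:] \<noteq> 0"
      by (simp add: pcompose_eq_0_iff)
    then show ?thesis
      using False root lin unfolding shift by (simp add: proots_mult del: mult_pCons_left)
  qed simp
qed simp

text \<open>At a point \<open>t\<close>, the matrix t 1 - (c 1 - A) is the negative of (c - t) 1 -
  A, and each of the \<open>n\<close> rows contributes a sign to the determinant. The field is
  infinite, so agreement at every \<open>t\<close> gives equality of polynomials.\<close>

lemma char_poly_reflect:
  fixes A :: "'a :: field_char_0 mat"
  assumes "A \<in> carrier_mat n n"
  shows "char_poly (c \<cdot>\<^sub>m 1\<^sub>m n - A) = (-1) ^ n * pcompose (char_poly A) [:c, -1:]"
proof (rule poly_ext)
  fix t
  have "- char_matrix (c \<cdot>\<^sub>m 1\<^sub>m n - A) t = (-1) \<cdot>\<^sub>m (- char_matrix A (c - t))"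
    using assms by (intro eq_matI) (auto simp: char_matrix_def)
  then have "poly (char_poly (c \<cdot>\<^sub>m 1\<^sub>m n - A)) t = (-1) ^ n * poly (char_poly A) (c - t)"
    using assms
    by (subst (1 2) char_poly_matrix[where n = n]) (auto simp: char_matrix_def)
  then show "poly (char_poly (c \<cdot>\<^sub>m 1\<^sub>m n - A)) t
      = poly ((-1) ^ n * pcompose (char_poly A) [:c, -1:]) t"
    by (simp add: poly_pcompose poly_power)
qed

lemma mat_spectrum_reflect:
  assumes "A \<in> carrier_mat n n"
  shows "mat_spectrum (c \<cdot>\<^sub>m 1\<^sub>m n - A) = image_mset (\<lambda>x. c - x) (mat_spectrum A)"
proof -
  have "proots ((-1) ^ n * p) = proots p" for p :: "real poly"
    by (cases "even n") auto
  then show ?thesis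
    by (simp add: mat_spectrum_def char_poly_reflect[OF assms] proots_pcompose_reflect)
qed

section \<open>Block matrices and low-rank updates\<close>

lemma char_poly_matrix_four_block:
  assumes "A \<in> carrier_mat n n" "B \<in> carrier_mat n m" "C \<in> carrier_mat m n" "D \<in> carrier_mat m m"
  shows "char_poly_matrix (four_block_mat A B C D)
    = four_block_mat (char_poly_matrix A) (map_mat (\<lambda>a. [:- a:]) B)
        (map_mat (\<lambda>a. [:- a:]) C) (char_poly_matrix D)"
  using assms by (intro eq_matI) (auto simp: char_poly_matrix_def)

lemma char_poly_four_block_lower_left_zero:
  fixes A D :: "'a :: idom mat"
  assumes "A \<in> carrier_mat n n" "B \<in> carrier_mat n m" "D \<in> carrier_mat m m"
  shows "char_poly (four_block_mat A B (0\<^sub>m m n) D) = char_poly A * char_poly D"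
proof -
  have "map_mat (\<lambda>a. [:- a:]) (0\<^sub>m m n) = (0\<^sub>m m n :: 'a poly mat)"
    by (intro eq_matI) auto
  then show ?thesis
    using assms
    by (simp add: char_poly_def char_poly_matrix_four_block[OF assms(1,2) _ assms(3)]
        det_four_block_mat_lower_left_zero[where n = n and m = m])
qed

lemma char_poly_2x2:
  fixes A :: "'a :: idom mat"
  assumes "A \<in> carrier_mat 2 2"
  shows "char_poly A = [:- (A $$ (0, 0)), 1:] * [:- (A $$ (1, 1)), 1:] - [:A $$ (0, 1) * A $$ (1, 0):]"
proof -
  let ?B = "\<lambda>i j. mat 1 1 (\<lambda>_. A $$ (i, j))"
  have "A = four_block_mat (?B 0 0) (?B 0 1) (?B 1 0) (?B 1 1)"
    using assms by (intro eq_matI) (auto simp: less_Suc_eq numeral_2_eq_2)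
  then have "char_poly A = det (four_block_mat (char_poly_matrix (?B 0 0))
      (map_mat (\<lambda>a. [:- a:]) (?B 0 1)) (map_mat (\<lambda>a. [:- a:]) (?B 1 0)) (char_poly_matrix (?B 1 1)))"
    by (metis char_poly_def char_poly_matrix_four_block mat_carrier)
  \<comment> \<open>This determinant formula asks two of the blocks to commute, as 1 x 1 blocks
    do.\<close>
  also have "\<dots> = det (char_poly_matrix (?B 0 0) * char_poly_matrix (?B 1 1)
      - map_mat (\<lambda>a. [:- a:]) (?B 0 1) * map_mat (\<lambda>a. [:- a:]) (?B 1 0))"
    by (rule det_four_block_mat[where n = 1]) (auto simp: char_poly_matrix_def scalar_prod_def intro!: eq_matI)
  also have "\<dots> = [:- (A $$ (0, 0)), 1:] * [:- (A $$ (1, 1)), 1:] - [:A $$ (0, 1) * A $$ (1, 0):]"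
    by (subst det_single) (auto simp: char_poly_matrix_def scalar_prod_def)
  finally show ?thesis .
qed

text \<open>The two sides are the characteristic polynomials of the block upper triangular matrices
  \<open>M\<close> and \<open>N\<close>, which are conjugate under the unipotent \<open>P\<close>.
  In \<open>P * N = M * P\<close> the terms with \<open>V * W\<close> and \<open>W * V\<close>
  cancel on the diagonal, and the lower left blocks are \<open>W * C\<close> and
  \<open>D * W\<close>. The product form avoids dividing by \<open>char_poly D\<close>.\<close>

lemma char_poly_low_rank_update:
  fixes C D :: "'a :: idom mat"
  assumes C: "C \<in> carrier_mat n n" and D: "D \<in> carrier_mat m m"
    and V: "V \<in> carrier_mat n m" and W: "W \<in> carrier_mat m n"
    and WC: "W * C = D * W"
  shows "char_poly (C + V * W) * char_poly D = char_poly C * char_poly (D + W * V)"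
proof -
  define N where "N = four_block_mat C (- V) (0\<^sub>m m n) (D + W * V)"
  define M where "M = four_block_mat (C + V * W) (- V) (0\<^sub>m m n) D"
  define P where "P = four_block_mat (1\<^sub>m n) (0\<^sub>m n m) W (1\<^sub>m m)"
  define R where "R = four_block_mat (1\<^sub>m n) (0\<^sub>m n m) (- W) (1\<^sub>m m)"
  have dims: "N \<in> carrier_mat (n + m) (n + m)" "M \<in> carrier_mat (n + m) (n + m)"
    "P \<in> carrier_mat (n + m) (n + m)" "R \<in> carrier_mat (n + m) (n + m)"
    using assms by (auto simp: N_def M_def P_def R_def)
  have PR: "P * R = 1\<^sub>m (n + m)" and RP: "R * P = 1\<^sub>m (n + m)"
    unfolding P_def R_def using W by (subst mult_four_block_mat[of _ n n _ m _ m _ _ n _ m]; auto intro!: eq_matI)+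
  have "P * N = four_block_mat C (- V) (W * C) D"
    unfolding P_def N_def using C D V W
    by (subst mult_four_block_mat[of _ n n _ m _ m _ _ n _ m]) (auto intro!: eq_matI)
  moreover have "M * P = four_block_mat C (- V) (D * W) D"
    unfolding P_def M_def using C D V W
    by (subst mult_four_block_mat[of _ n n _ m _ m _ _ n _ m]) (auto intro!: eq_matI)
  ultimately have "P * N = M * P"
    by (simp add: WC)
  then have "M = P * N * R"
    using dims PR by (metis assoc_mult_mat right_mult_one_mat)
  then have "similar_mat M N"
    using dims PR RP by (intro similar_matI[of _ _ P R "n + m"]) auto
  then have "char_poly M = char_poly N"
    by (rule char_poly_similar)
  then show ?thesis
    unfolding M_def N_def using C D V W
    by (simp add: char_poly_four_block_lower_left_zero[where n = n and m = m])
qed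

text \<open>Constant column sums make the all-ones row a left eigenvector of \<open>A\<close> with
  eigenvalue \<open>d\<close> and of \<open>B\<close> with eigenvalue \<open>e\<close>. This is the
  intertwining relation that the low-rank update requires. The last factor on the right belongs to
  the 2 x 2 quotient matrix.\<close>

lemma char_poly_equitable_update:
  fixes A B :: "'a :: idom mat"
  assumes A: "A \<in> carrier_mat n n" and B: "B \<in> carrier_mat m m"
    and sumA: "\<And>j. j < n \<Longrightarrow> (\<Sum>i<n. A $$ (i, j)) = d"
    and sumB: "\<And>j. j < m \<Longrightarrow> (\<Sum>i<m. B $$ (i, j)) = e"
  shows "char_poly (four_block_mat (A + mat n n (\<lambda>_. s)) (mat n m (\<lambda>_. t))
        (mat m n (\<lambda>_. t)) (B + mat m m (\<lambda>_. s))) * ([:- d, 1:] * [:- e, 1:])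
    = char_poly A * char_poly B
      * ([:- (d + of_nat n * s), 1:] * [:- (e + of_nat m * s), 1:] - [:of_nat n * of_nat m * t\<^sup>2:])"
proof -
  define K :: "nat \<Rightarrow> nat \<Rightarrow> 'a \<Rightarrow> 'a mat" where "K p q x = mat p q (\<lambda>_. x)" for p q x
  have K [simp]: "K p q x \<in> carrier_mat p q" "dim_row (K p q x) = p" "dim_col (K p q x) = q" for p q x
    by (auto simp: K_def)
  define C where "C = four_block_mat A (0\<^sub>m n m) (0\<^sub>m m n) B"
  define D where "D = four_block_mat (K 1 1 d) (0\<^sub>m 1 1) (0\<^sub>m 1 1) (K 1 1 e)"
  define V where "V = four_block_mat (K n 1 s) (K n 1 t) (K m 1 t) (K m 1 s)"
  define W where "W = four_block_mat (K 1 n 1) (0\<^sub>m 1 m) (0\<^sub>m 1 n) (K 1 m 1)"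
  have C: "C \<in> carrier_mat (n + m) (n + m)"
    using A B by (auto simp: C_def)
  have D: "D \<in> carrier_mat 2 2"
    by (auto simp: D_def)
  have V: "V \<in> carrier_mat (n + m) 2"
    by (auto simp: V_def)
  have W: "W \<in> carrier_mat 2 (n + m)"
    by (auto simp: W_def)
  have KK: "K p q x * K q r y = K p r (of_nat q * x * y)" for p q r x y
    by (intro eq_matI) (auto simp: K_def scalar_prod_def)
  have KA: "K 1 n 1 * A = K 1 n d"
    using A sumA by (intro eq_matI) (auto simp: K_def scalar_prod_def atLeast0LessThan)
  have KB: "K 1 m 1 * B = K 1 m e"
    using B sumB by (intro eq_matI) (auto simp: K_def scalar_prod_def atLeast0LessThan)
  have "W * C = four_block_mat (K 1 n d) (0\<^sub>m 1 m) (0\<^sub>m 1 n) (K 1 m e)"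
    unfolding W_def C_def using A B
    by (subst mult_four_block_mat[of _ 1 n _ m _ 1 _ _ n _ m]) (auto simp: KA KB simp del: One_nat_def)
  moreover have "D * W = four_block_mat (K 1 n d) (0\<^sub>m 1 m) (0\<^sub>m 1 n) (K 1 m e)"
    unfolding W_def D_def
    by (subst mult_four_block_mat[of _ 1 1 _ 1 _ 1 _ _ n _ m]) (auto simp: KK)
  ultimately have WC: "W * C = D * W"
    by simp
  have "V * W = four_block_mat (K n n s) (K n m t) (K m n t) (K m m s)"
    unfolding W_def V_def
    by (subst mult_four_block_mat[of _ n 1 _ 1 _ m _ _ n _ m]) (auto simp: KK)
  then have Q: "C + V * W = four_block_mat (A + K n n s) (K n m t) (K m n t) (B + K m m s)"
    unfolding C_def using A B by (intro eq_matI) auto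
  \<comment> \<open>Multiplying by \<open>W\<close> sums the rows of \<open>V\<close> over each
    part, hence the factors \<open>n\<close> and \<open>m\<close>. The off-diagonal entries enter
    the characteristic polynomial only through their product.\<close>
  have "W * V = four_block_mat (K 1 1 (of_nat n * s)) (K 1 1 (of_nat n * t))
      (K 1 1 (of_nat m * t)) (K 1 1 (of_nat m * s))"
    unfolding W_def V_def
    by (subst mult_four_block_mat[of _ 1 n _ m _ 1 _ _ 1 _ 1]) (auto simp: KK)
  then have T: "D + W * V = four_block_mat (K 1 1 (d + of_nat n * s)) (K 1 1 (of_nat n * t))
      (K 1 1 (of_nat m * t)) (K 1 1 (e + of_nat m * s))"
    unfolding D_def by (intro eq_matI) (auto simp: K_def)
  have "char_poly D = [:- d, 1:] * [:- e, 1:]"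
    by (subst char_poly_2x2[OF D]) (simp add: D_def K_def)
  moreover have "char_poly (D + W * V)
      = [:- (d + of_nat n * s), 1:] * [:- (e + of_nat m * s), 1:] - [:of_nat n * of_nat m * t\<^sup>2:]"
    using D W V
    by (subst char_poly_2x2) (auto simp: T, auto simp: K_def power2_eq_square algebra_simps)
  moreover have "char_poly C = char_poly A * char_poly B"
    unfolding C_def using A B by (simp add: char_poly_four_block_lower_left_zero)
  ultimately show ?thesis
    using char_poly_low_rank_update[OF C D V W WC] unfolding Q by (simp add: K_def)
qed

section \<open>Distances and transmissions in a join\<close>

lemma graph_dist_eqI:
  assumes "pair_wf_digraph G" and p: "pre_digraph.awalk (with_proj G) u p v"
    and "\<And>q. pre_digraph.awalk (with_proj G) u q v \<Longrightarrow> length p \<le> length q"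
  shows "graph_dist G u v = real (length p)"
proof -
  interpret pair_wf_digraph G by fact
  \<comment> \<open>With unit weights the cost of a walk is its length, so the infimum defining
    \<mu> is attained at \<open>p\<close>.\<close>
  have "\<mu> (\<lambda>_. 1) u v = ereal (real (length p))"
    unfolding \<mu>_def using assms
    by (intro antisym INF_greatest INF_lower2[of p]) (auto simp: awalk_cost_def sum_list_triv)
  then show ?thesis
    by (simp add: graph_dist_def)
qed

text \<open>A walk with 0, 1 or 2 arcs is exhibited in each case. It is shortest because an empty
  walk joins only equal vertices and a walk with one arc only adjacent ones.\<close>

lemma graph_dist_le_2:
  assumes "pair_wf_digraph G" "u \<in> pverts G"
    and "u \<noteq> v \<Longrightarrow> (u, v) \<notin> parcs G \<Longrightarrow> \<exists>w. (u, w) \<in> parcs G \<and> (w, v) \<in> parcs G"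
  shows "graph_dist G u v = (if u = v then 0 else if (u, v) \<in> parcs G then 1 else 2)"
proof -
  interpret pair_wf_digraph G by fact
  have walk: "awalk u p v \<longleftrightarrow> set p \<subseteq> parcs G \<and> pcas u p v" for p
    using assms(2) by (simp add: awalk_def)
  have dist: "graph_dist G u v = real (length p)"
    if "set p \<subseteq> parcs G" "pcas u p v"
      and "\<And>q. set q \<subseteq> parcs G \<Longrightarrow> pcas u q v \<Longrightarrow> length p \<le> length q" for p
    using that by (intro graph_dist_eqI[OF assms(1)]) (simp_all add: walk)
  consider "u = v" | "u \<noteq> v" "(u, v) \<in> parcs G"
    | w where "u \<noteq> v" "(u, v) \<notin> parcs G" "(u, w) \<in> parcs G" "(w, v) \<in> parcs G"
    using assms(3) by blast
  then show ?thesis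
  proof cases
    case 1
    then show ?thesis
      using dist[of "[]"] by simp
  next
    case 2
    then have "1 \<le> length q" if "pcas u q v" for q
      using that by (cases q) auto
    with 2 show ?thesis
      using dist[of "[(u, v)]"] by simp
  next
    case 3
    then have "length [(u, w), (w, v)] \<le> length q" if "set q \<subseteq> parcs G" "pcas u q v" for q
      \<comment> \<open>The rule splits \<open>q\<close> into the empty list, a singleton, and a
        list with at least two entries.\<close>
      using that by (cases q rule: remdups_adj.cases) auto
    with 3 have "graph_dist G u v = real (length [(u, w), (w, v)])"
      by (intro dist) auto
    with 3 show ?thesis
      by simp
  qed
qed

text \<open>Lets facts proved for the first graph of a join be applied to the second.\<close>

lemma graph_join_commute: "G \<nabla> H = H \<nabla> G"
  by (auto simp: graph_join_def)

lemma sum_out_arcs_regular: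
  assumes "pair_graph G" "regular G r" "u \<in> pverts G"
  shows "(\<Sum>v\<in>pverts G. if (u, v) \<in> parcs G then 1 else 0) = real r"
proof -
  interpret G: pair_graph G by fact
  have "out_arcs (with_proj G) u = Pair u ` {v \<in> pverts G. (u, v) \<in> parcs G}"
    by (auto simp: out_arcs_def dest: G.wellformed')
  then have "card {v \<in> pverts G. (u, v) \<in> parcs G} = out_degree (with_proj G) u"
    by (simp add: out_degree_def card_image inj_on_def)
  also have "\<dots> = r"
    using assms by (simp add: regular_def)
  finally have "card {v \<in> pverts G. (u, v) \<in> parcs G} = r" .
  then show ?thesis
    using G.pair_finite_verts by (simp add: sum.If_cases Int_def)
qed

context
  fixes G H :: "'a pair_pre_digraph"
  assumes G: "pair_graph G" and H: "pair_graph H" and disj: "pverts G \<inter> pverts H = {}"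
begin

lemma graph_dist_join_across:
  assumes "u \<in> pverts G" "v \<in> pverts H"
  shows "graph_dist (G \<nabla> H) u v = 1"
proof -
  interpret J: pair_graph "G \<nabla> H"
    using G H disj by (rule pair_graph_graph_join)
  show ?thesis
    using assms disj by (subst graph_dist_le_2) (auto simp: graph_join_def J.pair_wf_digraph[unfolded graph_join_def])
qed

text \<open>Any vertex of \<open>H\<close> is a common neighbour of \<open>u\<close> and
  \<open>v\<close>. Written as a difference, the distance can be summed termwise and corresponds to
  the matrix 2 J - 2 I - A, with J the all-ones matrix.\<close>

lemma graph_dist_join_within:
  assumes "u \<in> pverts G" "v \<in> pverts G" "pverts H \<noteq> {}"
  shows "graph_dist (G \<nabla> H) u v
    = 2 - (if u = v then 2 else 0) - (if (u, v) \<in> parcs G then 1 else 0)"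
proof -
  interpret G: pair_graph G by (rule G)
  interpret H: pair_graph H by (rule H)
  interpret J: pair_graph "G \<nabla> H"
    using G H disj by (rule pair_graph_graph_join)
  have "(u, v) \<in> parcs (G \<nabla> H) \<longleftrightarrow> (u, v) \<in> parcs G"
    using assms disj by (auto simp: graph_join_def dest: H.wellformed')
  moreover have "\<exists>w. (u, w) \<in> parcs (G \<nabla> H) \<and> (w, v) \<in> parcs (G \<nabla> H)"
    using assms by (auto simp: graph_join_def)
  moreover have "u \<in> pverts (G \<nabla> H)"
    using assms by (simp add: graph_join_def)
  ultimately show ?thesis
    using G.no_loops' by (subst graph_dist_le_2) auto
qed

lemma transmission_join:
  assumes "regular G r" "u \<in> pverts G" "pverts H \<noteq> {}"
  shows "transmission (G \<nabla> H) u
    = 2 * real (card (pverts G)) + real (card (pverts H)) - real r - 2"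
proof -
  interpret G: pair_graph G by (rule G)
  interpret H: pair_graph H by (rule H)
  have "transmission (G \<nabla> H) u
      = (\<Sum>v\<in>pverts G. graph_dist (G \<nabla> H) u v) + (\<Sum>v\<in>pverts H. graph_dist (G \<nabla> H) u v)"
    using disj G.pair_finite_verts H.pair_finite_verts
    by (simp add: transmission_def graph_join_def sum.union_disjoint)
  also have "\<dots> = 2 * real (card (pverts G)) - 2 - real r + real (card (pverts H))"
    using assms sum_out_arcs_regular[OF G assms(1,2)] G.pair_finite_verts
    by (simp add: graph_dist_join_within graph_dist_join_across sum_subtractf)
  finally show ?thesis
    by simp
qed

end

section \<open>Matrices along an enumeration of the vertices\<close>

lemma list_mat_carrier [simp]: "list_mat vs f \<in> carrier_mat (length vs) (length vs)"
  by (simp add: list_mat_def)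

lemma list_mat_append:
  "list_mat (vs @ ws) f = four_block_mat (list_mat vs f)
    (mat (length vs) (length ws) (\<lambda>(i, j). f (vs ! i) (ws ! j)))
    (mat (length ws) (length vs) (\<lambda>(i, j). f (ws ! i) (vs ! j))) (list_mat ws f)"
  by (intro eq_matI) (auto simp: list_mat_def nth_append)

lemma distance_signless_laplacian_enum_mat:
  "distance_signless_laplacian G = enum_mat (pverts G)
    (\<lambda>u v. (if u = v then transmission G u else 0) + graph_dist G u v)"
  unfolding distance_signless_laplacian_def transmission_matrix_def distance_matrix_def
  by (intro eq_matI) (auto simp: enum_mat_def list_mat_def)

lemma adjacency_matrix_carrier:
  assumes "finite (pverts G)"
  shows "adjacency_matrix G \<in> carrier_mat (card (pverts G)) (card (pverts G))"
  using enumeration[OF assms]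
  by (metis adjacency_matrix_def distinct_card enum_mat_def list_mat_carrier)

lemma adjacency_matrix_col_sum:
  assumes "pair_graph G" "regular G r" and j: "j < card (pverts G)"
  shows "(\<Sum>i<card (pverts G). adjacency_matrix G $$ (i, j)) = real r"
proof -
  interpret pair_graph G by fact
  let ?vs = "enumeration (pverts G)"
  have vs: "distinct ?vs" "set ?vs = pverts G"
    using enumeration[OF pair_finite_verts] by auto
  then have len: "length ?vs = card (pverts G)"
    by (metis distinct_card)
  \<comment> \<open>Symmetry of the arc set turns the column sum into a count of outgoing
    arcs.\<close>
  have "(\<Sum>i<card (pverts G). adjacency_matrix G $$ (i, j))
      = (\<Sum>i<length ?vs. (if (?vs ! j, ?vs ! i) \<in> parcs G then 1 else 0))"
    using j len arcs_symmetric
    by (intro sum.cong) (auto simp: adjacency_matrix_def enum_mat_def list_mat_def)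
  also have "\<dots> = (\<Sum>v\<in>pverts G. if (?vs ! j, v) \<in> parcs G then 1 else 0)"
    using bij_betw_nth[OF vs(1) refl refl] vs(2)
    by (intro sum.reindex_bij_betw[where h = "(!) ?vs"]) simp
  also have "\<dots> = real r"
    using vs(2) j len nth_mem[of j ?vs] by (intro sum_out_arcs_regular[OF assms(1,2)]) simp
  finally show ?thesis .
qed

lemma sum_col_scalar_minus:
  fixes X :: "'a :: comm_ring_1 mat"
  assumes "X \<in> carrier_mat n n" "j < n"
  shows "(\<Sum>i<n. (c \<cdot>\<^sub>m 1\<^sub>m n - X) $$ (i, j)) = c - (\<Sum>i<n. X $$ (i, j))"
proof -
  have "(\<Sum>i<n. (c \<cdot>\<^sub>m 1\<^sub>m n - X) $$ (i, j)) = (\<Sum>i<n. (if i = j then c else 0) - X $$ (i, j))"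
    using assms by (intro sum.cong) auto
  then show ?thesis
    using assms(2) by (simp add: sum_subtractf)
qed

text \<open>In the constant 4, one 2 comes from the transmission; the other offsets the 2 that the
  constant matrix places on the diagonal, where the distance is 0.\<close>

lemma list_mat_join_within:
  fixes G H :: "'a pair_pre_digraph"
  assumes G: "pair_graph G" and H: "pair_graph H" and disj: "pverts G \<inter> pverts H = {}"
    and ne: "pverts H \<noteq> {}" and reg: "regular G r"
  defines "n \<equiv> card (pverts G)"
  shows "list_mat (enumeration (pverts G))
      (\<lambda>u v. (if u = v then transmission (G \<nabla> H) u else 0) + graph_dist (G \<nabla> H) u v)
    = ((2 * real n + real (card (pverts H)) - real r - 4) \<cdot>\<^sub>m 1\<^sub>m n - adjacency_matrix G)
      + mat n n (\<lambda>_. 2)"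
proof -
  interpret pair_graph G by (rule G)
  let ?vs = "enumeration (pverts G)"
  have vs: "distinct ?vs" "set ?vs = pverts G"
    using enumeration[OF pair_finite_verts] by auto
  then have len: "length ?vs = n"
    unfolding n_def by (metis distinct_card)
  have mem: "?vs ! i \<in> pverts G" if "i < n" for i
    using that len vs(2) nth_mem by metis
  show ?thesis
    using len vs(1) mem ne no_loops'
    by (intro eq_matI)
      (auto simp: list_mat_def adjacency_matrix_def enum_mat_def nth_eq_iff_index_eq
        graph_dist_join_within[OF G H disj] transmission_join[OF G H disj reg, folded n_def])
qed

section \<open>The quotient eigenvalues and the spectrum of the join\<close>

lemma proots_quadratic:
  fixes a b c :: real
  assumes "(a - b)\<^sup>2 + 4 * c = \<Delta>" "\<Delta> \<ge> 0"
  shows "proots ([:- a, 1:] * [:- b, 1:] - [:c:])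
    = {# (a + b) / 2 + sqrt \<Delta> / 2, (a + b) / 2 - sqrt \<Delta> / 2 #}"
proof -
  \<comment> \<open>By Vieta it suffices that \<open>x\<close> and \<open>y\<close> have sum
    \<open>a + b\<close> and product \<open>a * b - c\<close>; nonnegativity of \<Delta> lets the
    squared root simplify.\<close>
  define x y where "x = (a + b) / 2 + sqrt \<Delta> / 2" and "y = (a + b) / 2 - sqrt \<Delta> / 2"
  have "x * y = ((a + b)\<^sup>2 - (sqrt \<Delta>)\<^sup>2) / 4"
    by (simp add: x_def y_def field_simps power2_eq_square)
  also have "\<dots> = a * b - c"
    using assms by (simp add: field_simps power2_eq_square)
  finally have "x * y = a * b - c" .
  moreover have "x + y = a + b"
    by (simp add: x_def y_def)
  moreover have "[:- x, 1:] * [:- y, 1:] = [:x * y, - (x + y), 1:]"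
    "[:- a, 1:] * [:- b, 1:] - [:c:] = [:a * b - c, - (a + b), 1:]"
    by simp_all
  ultimately have "[:- a, 1:] * [:- b, 1:] - [:c:] = [:- x, 1:] * [:- y, 1:]"
    by metis
  moreover have "proots ([:- x, 1:] * [:- y, 1:]) = {#x, y#}"
    by (subst proots_mult) simp_all
  ultimately have "proots ([:- a, 1:] * [:- b, 1:] - [:c:]) = {#x, y#}"
    by (simp only:)
  then show ?thesis
    by (simp only: x_def y_def)
qed

theorem theorem3p13:
  fixes G1 G2 :: "'a pair_pre_digraph"
    and n1 n2 r1 r2 :: nat
    and lam mu :: "nat \<Rightarrow> real"
    and \<Delta> :: real
  assumes "pair_graph G1" and "pair_graph G2"
    and "pverts G1 \<inter> pverts G2 = {}"
    and "card (pverts G1) = n1" and "card (pverts G2) = n2"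
    and "n1 \<ge> 1" and "n2 \<ge> 1"
    and "regular G1 r1" and "regular G2 r2"
    and "mat_spectrum (adjacency_matrix G1) = image_mset lam (mset_set {1..n1})"
    and "lam 1 = real r1"
    and "mat_spectrum (adjacency_matrix G2) = image_mset mu (mset_set {1..n2})"
    and "mu 1 = real r2"
    and "\<Delta> = 9 * real n1 ^ 2 - 14 * real n1 * real n2 - 12 * real n1 * real r1
            + 12 * real n1 * real r2 + 9 * real n2 ^ 2 + 12 * real n2 * real r1
            - 12 * real n2 * real r2 + 4 * real r1 ^ 2 - 8 * real r1 * real r2 + 4 * real r2 ^ 2"
  shows "mat_spectrum (distance_signless_laplacian (G1 \<nabla> G2)) =
      image_mset (\<lambda>j. 2 * real n1 + real n2 - real r1 - lam j - 4) (mset_set {2..n1})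
    + image_mset (\<lambda>j. 2 * real n2 + real n1 - real r2 - mu j - 4) (mset_set {2..n2})
    + {# 5 / 2 * (real n1 + real n2) - real r1 - real r2 - 4 + sqrt \<Delta> / 2,
         5 / 2 * (real n1 + real n2) - real r1 - real r2 - 4 - sqrt \<Delta> / 2 #}"
proof -
  interpret G1: pair_graph G1 by fact
  interpret G2: pair_graph G2 by fact
  have ne: "pverts G1 \<noteq> {}" "pverts G2 \<noteq> {}"
    using assms(4-7) by auto
  have disj': "pverts G2 \<inter> pverts G1 = {}"
    using assms(3) by auto
  let ?vs = "enumeration (pverts G1)" and ?ws = "enumeration (pverts G2)"
  have vs: "distinct ?vs" "set ?vs = pverts G1" and ws: "distinct ?ws" "set ?ws = pverts G2"
    by (simp_all add: enumeration G1.pair_finite_verts G2.pair_finite_verts)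
  have len: "length ?vs = n1" "length ?ws = n2"
    using distinct_card[OF vs(1)] distinct_card[OF ws(1)] vs(2) ws(2) assms(4,5) by simp_all
  have mem: "i < n1 \<Longrightarrow> ?vs ! i \<in> pverts G1" "j < n2 \<Longrightarrow> ?ws ! j \<in> pverts G2" for i j
    using len vs(2) ws(2) nth_mem[of i ?vs] nth_mem[of j ?ws] by simp_all
  have apart: "?vs ! i \<noteq> ?ws ! j" if "i < n1" "j < n2" for i j
    using mem(1)[OF that(1)] mem(2)[OF that(2)] assms(3) by auto
  define c where "c = 2 * real n1 + real n2 - real r1 - 4"
  define d where "d = 2 * real n2 + real n1 - real r2 - 4"
  define A where "A = c \<cdot>\<^sub>m 1\<^sub>m n1 - adjacency_matrix G1"
  define B where "B = d \<cdot>\<^sub>m 1\<^sub>m n2 - adjacency_matrix G2"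
  have adj: "adjacency_matrix G1 \<in> carrier_mat n1 n1" "adjacency_matrix G2 \<in> carrier_mat n2 n2"
    using adjacency_matrix_carrier[OF G1.pair_finite_verts]
      adjacency_matrix_carrier[OF G2.pair_finite_verts] assms(4,5) by simp_all
  then have AB: "A \<in> carrier_mat n1 n1" "B \<in> carrier_mat n2 n2"
    by (auto simp: A_def B_def)
  let ?q = "\<lambda>u v. (if u = v then transmission (G1 \<nabla> G2) u else 0) + graph_dist (G1 \<nabla> G2) u v"
  have Q: "list_mat (?vs @ ?ws) ?q = four_block_mat (A + mat n1 n1 (\<lambda>_. 2)) (mat n1 n2 (\<lambda>_. 1))
      (mat n2 n1 (\<lambda>_. 1)) (B + mat n2 n2 (\<lambda>_. 2))"
  proof -
    have "list_mat ?vs ?q = A + mat n1 n1 (\<lambda>_. 2)"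
      using list_mat_join_within[OF assms(1-3) ne(2) assms(8)] assms(4,5) by (simp add: A_def c_def)
    moreover have "list_mat ?ws ?q = B + mat n2 n2 (\<lambda>_. 2)"
      using list_mat_join_within[OF assms(2,1) disj' ne(1) assms(9)] assms(4,5)
      by (simp add: B_def d_def graph_join_commute[of G2 G1] cong: if_cong)
    moreover have "mat n1 n2 (\<lambda>(i, j). ?q (?vs ! i) (?ws ! j)) = mat n1 n2 (\<lambda>_. 1)"
      using mem apart graph_dist_join_across[OF assms(1-3)] by (intro eq_matI) auto
    moreover have "mat n2 n1 (\<lambda>(i, j). ?q (?ws ! i) (?vs ! j)) = mat n2 n1 (\<lambda>_. 1)"
      using mem apart[symmetric] graph_dist_join_across[OF assms(2,1) disj']
      by (intro eq_matI) (auto simp: graph_join_commute[of G2 G1])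
    ultimately show ?thesis
      by (simp add: list_mat_append len)
  qed
  \<comment> \<open>The enumeration chosen for the union may differ from the concatenation that
    produces the blocks, but the characteristic polynomial is the same.\<close>
  have cp: "char_poly (distance_signless_laplacian (G1 \<nabla> G2)) = char_poly (list_mat (?vs @ ?ws) ?q)"
  proof -
    have "pverts (G1 \<nabla> G2) = set (?vs @ ?ws)"
      using vs ws by (simp add: graph_join_def)
    moreover have "distinct (?vs @ ?ws)"
      using vs ws assms(3) by simp
    ultimately show ?thesis
      by (simp only: distance_signless_laplacian_enum_mat char_poly_enum_mat)
  qed
  have sumA: "(\<Sum>i<n1. A $$ (i, j)) = c - real r1" if "j < n1" for j
    unfolding A_def sum_col_scalar_minus[OF adj(1) that]
    using adjacency_matrix_col_sum[OF assms(1,8)] that assms(4) by simp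
  have sumB: "(\<Sum>i<n2. B $$ (i, j)) = d - real r2" if "j < n2" for j
    unfolding B_def sum_col_scalar_minus[OF adj(2) that]
    using adjacency_matrix_col_sum[OF assms(2,9)] that assms(5) by simp
  \<comment> \<open>\<open>a\<close> and \<open>b\<close> are the diagonal entries of the quotient
    matrix for the weights 2 and 1; the product of its off-diagonal entries is n1 n2.\<close>
  define a where "a = c - real r1 + real n1 * 2"
  define b where "b = d - real r2 + real n2 * 2"
  define P where "P = [:- a, 1:] * [:- b, 1:] - [:real n1 * real n2:]"
  define R where "R = [:- (c - real r1), 1:] * [:- (d - real r2), 1:]"
  have eq: "char_poly (distance_signless_laplacian (G1 \<nabla> G2)) * R = char_poly A * char_poly B * P"
    using char_poly_equitable_update[OF AB sumA sumB, of 2 1]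
    by (simp only: cp Q P_def R_def a_def b_def power_one mult_1_right)
  \<comment> \<open>Here a - b = 3 (n1 - n2) - 2 (r1 - r2). Writing \<Delta> as a square plus 4 n1
    n2 also shows that it is nonnegative, so both quotient eigenvalues are real.\<close>
  have \<Delta>: "(a - b)\<^sup>2 + 4 * (real n1 * real n2) = \<Delta>"
    unfolding assms(14) a_def b_def c_def d_def by (simp add: power2_eq_square algebra_simps)
  have "0 \<le> (a - b)\<^sup>2 + 4 * (real n1 * real n2)"
    by simp
  then have "\<Delta> \<ge> 0"
    unfolding \<Delta> .
  from proots_quadratic[OF \<Delta> this]
  have prootsP: "proots P = {# (a + b) / 2 + sqrt \<Delta> / 2, (a + b) / 2 - sqrt \<Delta> / 2 #}"
    by (simp only: P_def)
  have prootsR: "proots R = {# c - real r1, d - real r2 #}"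
    unfolding R_def by (subst proots_mult) simp_all
  \<comment> \<open>Roots of a product add up as multisets only when no factor vanishes.\<close>
  have "P \<noteq> 0" "R \<noteq> 0"
    by (simp_all add: P_def R_def)
  moreover have "char_poly X \<noteq> 0" if "X \<in> carrier_mat n n" for X :: "real mat" and n
    using degree_monic_char_poly[OF that] by auto
  moreover have "distance_signless_laplacian (G1 \<nabla> G2) \<in> carrier_mat
      (length (enumeration (pverts (G1 \<nabla> G2)))) (length (enumeration (pverts (G1 \<nabla> G2))))"
    by (simp add: distance_signless_laplacian_enum_mat enum_mat_def)
  ultimately have "proots (char_poly (distance_signless_laplacian (G1 \<nabla> G2))) + proots R
      = proots (char_poly A) + proots (char_poly B) + proots P"
    using arg_cong[OF eq, of proots] AB by (simp add: proots_mult)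
  \<comment> \<open>Index 1 is split off: \<open>lam 1 = r1\<close> reflects to
    \<open>c - r1\<close>, a root of \<open>R\<close>.\<close>
  moreover have "proots (char_poly A) = add_mset (c - real r1) (image_mset (\<lambda>j. c - lam j) (mset_set {2..n1}))"
  proof -
    have "{1..n1} = insert 1 {2..n1}"
      using assms(6) by auto
    then show ?thesis
      using mat_spectrum_reflect[OF adj(1), of c] assms(10,11)
      by (simp add: A_def mat_spectrum_def image_mset.compositionality comp_def)
  qed
  moreover have "proots (char_poly B) = add_mset (d - real r2) (image_mset (\<lambda>j. d - mu j) (mset_set {2..n2}))"
  proof -
    have "{1..n2} = insert 1 {2..n2}"
      using assms(7) by auto
    then show ?thesis
      using mat_spectrum_reflect[OF adj(2), of d] assms(12,13)
      by (simp add: B_def mat_spectrum_def image_mset.compositionality comp_def)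
  qed
  \<comment> \<open>Both roots of \<open>R\<close> now occur on either side of the multiset equation
    and cancel, leaving the reflected eigenvalues of index at least 2 and the roots of
    \<open>P\<close>.\<close>
  ultimately show ?thesis
    unfolding mat_spectrum_def prootsP prootsR
    by (simp add: a_def b_def c_def d_def algebra_simps add_divide_distrib diff_divide_distrib)
qed

end
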